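(* The dicyclic group $\mathbb{Q}_{4n}$ has Lee metrics for every $n\ge 2$.
   Context: $\mathbb{Q}_{4n}=\langle x,y: x^{2n}=e,\ y^2=x^n,\ y^{-1}xy=x^{-1}\rangle$ is the dicyclic group of order $4n$. All metrics on groups are integral (integer valued) and right translation invariant: $d(gh,g'h)=d(g,g')$ for all $g,g',h\in G$. The weight of $d$ is $w(x)=d(x,e)$, $e$ the identity of $G$. The partition induced by $d$, denoted $P(G,d)$, is the set of classes of the equivalence relation $g\sim h\Leftrightarrow w(g)=w(h)$. An interval metric is such a metric $d$ with finitely many weights and without gaps: if $P(G,d)$ has $m$ parts different from $\{e\}$, then the set of values of $w$ is exactly $\{0,1,\ldots,m\}$. The Lee partition of $G$ is $\mathcal{P}_{Lee}(G)=\{\{a,a^{-1}\}:a\in G\}$. A Lee metric on $G$ is an interval metric $d$ on $G$ with $P(G,d)=\mathcal{P}_{Lee}(G)$. *)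

theory Defs
  imports "HOL-Analysis.Abstract_Metric_Spaces" "HOL-Algebra.Group"
begin
text \<open>A letter \<open>(a, True)\<close> stands for the generator \<open>a\<close>, and \<open>(a, False)\<close> for its formal inverse.
  A pair \<open>(r, s)\<close> in \<open>R\<close> stands for the defining relation \<open>r = s\<close>.\<close>

type_synonym 'g word = "('g \<times> bool) list"

inductive pres_eq :: "('g word \<times> 'g word) set \<Rightarrow> 'g word \<Rightarrow> 'g word \<Rightarrow> bool"
  for R :: "('g word \<times> 'g word) set" where
  refl: "pres_eq R u u"
| sym: "pres_eq R u v \<Longrightarrow> pres_eq R v u"
| trans: "pres_eq R u v \<Longrightarrow> pres_eq R v w \<Longrightarrow> pres_eq R u w"
| cancel: "pres_eq R (u @ [(a, b), (a, \<not> b)] @ v) (u @ v)"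
| rel: "(r, s) \<in> R \<Longrightarrow> pres_eq R (u @ r @ v) (u @ s @ v)"

definition pres_rel :: "('g word \<times> 'g word) set \<Rightarrow> ('g word \<times> 'g word) set" where
  "pres_rel R = {(u, v). pres_eq R u v}"

definition presented_group :: "('g word \<times> 'g word) set \<Rightarrow> 'g word set monoid" where
  "presented_group R =
     \<lparr> carrier = UNIV // pres_rel R,
       monoid.mult = (\<lambda>A B. \<Union>u\<in>A. \<Union>v\<in>B. pres_rel R `` {u @ v}),
       one = pres_rel R `` {[]} \<rparr>"

lemma equiv_pres_rel: "equiv UNIV (pres_rel R)"
  by (rule equivI) (auto simp: pres_rel_def refl_on_def sym_def trans_def intro: pres_eq.intros)

lemma pres_eq_context:
  assumes "pres_eq R u v"
  shows "pres_eq R (p @ u @ q) (p @ v @ q)"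
  using assms
proof induction
  case (cancel u a b v)
  show ?case using pres_eq.cancel[of R "p @ u" a b "v @ q"] by simp
next
  case (rel r s u v)
  then show ?case using pres_eq.rel[of r s R "p @ u" "v @ q"] by simp
qed (auto intro: pres_eq.refl pres_eq.sym pres_eq.trans)

lemma pres_eq_append:
  assumes "pres_eq R u u'" "pres_eq R v v'"
  shows "pres_eq R (u @ v) (u' @ v')"
  using pres_eq_context[OF assms(1), of "[]" v] pres_eq_context[OF assms(2), of u' "[]"]
  by (auto intro: pres_eq.trans)

lemma presented_group_mult:
  "(pres_rel R `` {u}) \<otimes>\<^bsub>presented_group R\<^esub> (pres_rel R `` {v}) = pres_rel R `` {u @ v}"
proof -
  have "congruent2 (pres_rel R) (pres_rel R) (\<lambda>u v. pres_rel R `` {u @ v})"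
  proof (rule congruent2I')
    fix u u' v v'
    assume "(u, u') \<in> pres_rel R" "(v, v') \<in> pres_rel R"
    then have "(u @ v, u' @ v') \<in> pres_rel R"
      by (simp add: pres_rel_def pres_eq_append)
    then show "pres_rel R `` {u @ v} = pres_rel R `` {u' @ v'}"
      by (rule equiv_class_eq[OF equiv_pres_rel])
  qed
  from UN_equiv_class2[OF equiv_pres_rel equiv_pres_rel this]
  show ?thesis by (simp add: presented_group_def)
qed

lemma pres_eq_inverse: "pres_eq R (rev (map (\<lambda>(a, b). (a, \<not> b)) u) @ u) []"
proof (induction u)
  case Nil
  show ?case by (simp add: pres_eq.refl)
next
  case (Cons c u)
  obtain a b where c: "c = (a, b)" by fastforce
  show ?case
    using pres_eq.cancel[of R "rev (map (\<lambda>(a, b). (a, \<not> b)) u)" a "\<not> b" u] Cons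
    by (auto simp: c intro: pres_eq.trans)
qed

lemma group_presented_group: "group (presented_group R)"
proof (rule groupI)
  have car: "x \<in> carrier (presented_group R) \<longleftrightarrow> (\<exists>u. x = pres_rel R `` {u})" for x
    by (auto simp: presented_group_def quotient_def)
  have one: "\<one>\<^bsub>presented_group R\<^esub> = pres_rel R `` {[]}"
    by (simp add: presented_group_def)
  fix x y z
  assume "x \<in> carrier (presented_group R)"
  then obtain u where x: "x = pres_rel R `` {u}" using car by blast
  show "\<one>\<^bsub>presented_group R\<^esub> \<otimes>\<^bsub>presented_group R\<^esub> x = x"
    by (simp add: one x presented_group_mult)
  have "(rev (map (\<lambda>(a, b). (a, \<not> b)) u) @ u, []) \<in> pres_rel R"
    by (simp add: pres_rel_def pres_eq_inverse)
  then have "pres_rel R `` {rev (map (\<lambda>(a, b). (a, \<not> b)) u)} \<otimes>\<^bsub>presented_group R\<^esub> x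
      = \<one>\<^bsub>presented_group R\<^esub>"
    unfolding one x presented_group_mult by (rule equiv_class_eq[OF equiv_pres_rel])
  then show "\<exists>y\<in>carrier (presented_group R).
      y \<otimes>\<^bsub>presented_group R\<^esub> x = \<one>\<^bsub>presented_group R\<^esub>"
    using car by blast
  assume "y \<in> carrier (presented_group R)"
  then obtain v where y: "y = pres_rel R `` {v}" using car by blast
  show "x \<otimes>\<^bsub>presented_group R\<^esub> y \<in> carrier (presented_group R)"
    unfolding car x y presented_group_mult by blast
  assume "z \<in> carrier (presented_group R)"
  then obtain w where z: "z = pres_rel R `` {w}" using car by blast
  show "x \<otimes>\<^bsub>presented_group R\<^esub> y \<otimes>\<^bsub>presented_group R\<^esub> z
      = x \<otimes>\<^bsub>presented_group R\<^esub> (y \<otimes>\<^bsub>presented_group R\<^esub> z)"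
    by (simp add: x y z presented_group_mult)
qed (auto simp: presented_group_def quotient_def)

datatype dicyclic_gen = GenX | GenY

definition dicyclic :: "nat \<Rightarrow> dicyclic_gen word set monoid" where
  "dicyclic n = presented_group
     {(replicate (2 * n) (GenX, True), []),
      ([(GenY, True), (GenY, True)], replicate n (GenX, True)),
      ([(GenY, False), (GenX, True), (GenY, True)], [(GenX, False)])}"

definition group_metric :: "('a, 'b) monoid_scheme \<Rightarrow> ('a \<Rightarrow> 'a \<Rightarrow> real) \<Rightarrow> bool" where
  "group_metric G d \<longleftrightarrow>
     Metric_space (carrier G) d \<and>
     (\<forall>g\<in>carrier G. \<forall>h\<in>carrier G. d g h \<in> \<int>) \<and>
     (\<forall>g\<in>carrier G. \<forall>g'\<in>carrier G. \<forall>h\<in>carrier G.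
        d (g \<otimes>\<^bsub>G\<^esub> h) (g' \<otimes>\<^bsub>G\<^esub> h) = d g g')"

definition weight :: "('a, 'b) monoid_scheme \<Rightarrow> ('a \<Rightarrow> 'a \<Rightarrow> real) \<Rightarrow> 'a \<Rightarrow> real" where
  "weight G d x = d x \<one>\<^bsub>G\<^esub>"

definition metric_partition :: "('a, 'b) monoid_scheme \<Rightarrow> ('a \<Rightarrow> 'a \<Rightarrow> real) \<Rightarrow> 'a set set" where
  "metric_partition G d =
     carrier G // {(g, h). g \<in> carrier G \<and> h \<in> carrier G \<and> weight G d g = weight G d h}"

definition interval_metric :: "('a, 'b) monoid_scheme \<Rightarrow> ('a \<Rightarrow> 'a \<Rightarrow> real) \<Rightarrow> bool" where
  "interval_metric G d \<longleftrightarrow>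
     group_metric G d \<and>
     finite (weight G d ` carrier G) \<and>
     weight G d ` carrier G = real ` {0..card (metric_partition G d - {{\<one>\<^bsub>G\<^esub>}})}"

definition lee_partition :: "('a, 'b) monoid_scheme \<Rightarrow> 'a set set" where
  "lee_partition G = {{a, inv\<^bsub>G\<^esub> a} | a. a \<in> carrier G}"

definition lee_metric :: "('a, 'b) monoid_scheme \<Rightarrow> ('a \<Rightarrow> 'a \<Rightarrow> real) \<Rightarrow> bool" where
  "lee_metric G d \<longleftrightarrow> interval_metric G d \<and> metric_partition G d = lee_partition G"

end

theory Submission imports Defs begin

text \<open>A Lee metric is the same as a subadditive length function whose level sets are the pairs
  \<open>{a, a\<inverse>}\<close> and whose values are \<open>0, \<dots>, 2n\<close>. We let the cyclic part \<open>\<langle>x\<rangle>\<close> take the values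
  \<open>0, \<dots>, n\<close> and the coset \<open>\<langle>x\<rangle>y\<close> the values \<open>n+1, \<dots>, 2n\<close>. Write \<open>|i|\<close> for the distance
  from \<open>i\<close> to the nearest multiple of \<open>n\<close>. The length of \<open>x\<^sup>i\<close> is \<open>2|i|\<close>, plus \<open>1\<close> if
  the nearest multiple is an odd one (a tie counts as even); in particular the central element \<open>x\<^sup>n\<close> has length \<open>1\<close>.
  On the coset \<open>\<langle>x\<rangle>y\<close> the classes \<open>{x\<^sup>jy, x\<^sup>j\<^sup>+\<^sup>ny}\<close> form an \<open>n\<close>-cycle, and its values run up through
  every second number and then back down, so that neighbours differ by at most \<open>2\<close> and
  multiplication by \<open>x\<^sup>i\<close> changes the length by at most \<open>2|i|\<close>. Products of two elements of the coset
  have length at most \<open>n\<close>, less than that of either factor.\<close>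

section \<open>Metrics from length functions\<close>

text \<open>The metric is d(x, y) = w(x y^-1): right invariance holds because h cancels in
  (gh)(g'h)^-1, and \<open>sub\<close> becomes the triangle inequality. In \<open>eq\<close>, y = 1
  makes the identity the only element of length 0, and y = x^-1 makes \<open>w\<close> invariant
  under inversion, hence d symmetric.\<close>

lemma lee_metric_of_length:
  fixes G (structure) and w :: "'a \<Rightarrow> int"
  assumes "group G"
    and one: "w \<one> = 0"
    and sub: "\<And>x y. x \<in> carrier G \<Longrightarrow> y \<in> carrier G \<Longrightarrow> w (x \<otimes> y) \<le> w x + w y"
    and eq: "\<And>x y. x \<in> carrier G \<Longrightarrow> y \<in> carrier G \<Longrightarrow> w x = w y \<longleftrightarrow> x = y \<or> x \<otimes> y = \<one>"
    and img: "w ` carrier G = {0..int m}"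
  shows "\<exists>d. lee_metric G d"
proof -
  interpret group G by fact
  \<comment> \<open>\<open>Metric_space\<close> demands nonnegativity and symmetry for all
    arguments, also outside the carrier, hence the default 0.\<close>
  define d where "d x y = (if x \<in> carrier G \<and> y \<in> carrier G
    then real_of_int (w (x \<otimes> inv y)) else 0)" for x y
  have winv: "w (inv x) = w x" if "x \<in> carrier G" for x
    using eq[of x "inv x"] that by simp
  have nonneg: "0 \<le> w x" if "x \<in> carrier G" for x
    using img that by auto
  have zero: "w x = 0 \<longleftrightarrow> x = \<one>" if "x \<in> carrier G" for x
    using eq[of x \<one>] that one by simp
  have "Metric_space (carrier G) d"
  proof
    fix x y z
    show "0 \<le> d x y" by (simp add: d_def nonneg)
    show "d x y = d y x"
    proof (cases "x \<in> carrier G \<and> y \<in> carrier G")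
      case True
      then have "w (inv (x \<otimes> inv y)) = w (x \<otimes> inv y)" by (intro winv) simp
      with True show ?thesis by (simp add: d_def inv_mult_group)
    qed (auto simp: d_def)
    assume x: "x \<in> carrier G" and y: "y \<in> carrier G"
    have "x \<otimes> inv y = \<one> \<longleftrightarrow> x = y"
      using x y by (metis inv_closed inv_inv inv_equality r_inv)
    then show "d x y = 0 \<longleftrightarrow> x = y"
      using x y by (simp add: d_def zero)
    assume z: "z \<in> carrier G"
    have "x \<otimes> inv z = (x \<otimes> inv y) \<otimes> (y \<otimes> inv z)"
      using x y z by (simp add: inv_solve_left m_assoc)
    then have "w (x \<otimes> inv z) \<le> w (x \<otimes> inv y) + w (y \<otimes> inv z)"
      using sub[of "x \<otimes> inv y" "y \<otimes> inv z"] x y z by simp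
    then show "d x z \<le> d x y + d y z"
      using x y z by (simp add: d_def)
  qed
  moreover have "d (g \<otimes> h) (g' \<otimes> h) = d g g'"
    if "g \<in> carrier G" "g' \<in> carrier G" "h \<in> carrier G" for g g' h
  proof -
    have "h \<otimes> (inv h \<otimes> inv g') = inv g'"
      using that by (simp flip: m_assoc)
    then have "(g \<otimes> h) \<otimes> inv (g' \<otimes> h) = g \<otimes> inv g'"
      using that by (simp add: inv_mult_group m_assoc)
    then show ?thesis using that by (simp add: d_def)
  qed
  ultimately have metric: "group_metric G d"
    by (simp add: group_metric_def d_def)
  have wt: "weight G d x = w x" if "x \<in> carrier G" for x
    using that by (simp add: weight_def d_def)
  define r where "r = {(g, h). g \<in> carrier G \<and> h \<in> carrier G \<and> weight G d g = weight G d h}"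
  have cls: "r `` {a} = {a, inv a}" if "a \<in> carrier G" for a
  proof -
    have "a = y \<or> a \<otimes> y = \<one> \<longleftrightarrow> y = a \<or> y = inv a" if "y \<in> carrier G" for y
      using that \<open>a \<in> carrier G\<close> by (metis inv_equality inv_inv r_inv inv_closed)
    then have "r `` {a} = {y \<in> carrier G. y = a \<or> y = inv a}"
      using that by (auto simp: r_def wt eq)
    then show ?thesis
      using that by auto
  qed
  have part: "metric_partition G d = lee_partition G"
    using cls by (auto simp: metric_partition_def lee_partition_def quotient_def simp flip: r_def)
  \<comment> \<open>\<open>interval_metric\<close> compares the values with the number of nontrivial
    parts. As \<open>img\<close> leaves no gap, each k from 1 to m yields exactly one part, that of
    a representative of length k.\<close>
  define rep where "rep k = (SOME x. x \<in> carrier G \<and> w x = k)" for k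
  have rep: "rep k \<in> carrier G \<and> w (rep k) = k" if "k \<in> {0..int m}" for k
  proof -
    have "\<exists>x. x \<in> carrier G \<and> w x = k"
      using that img by (metis image_iff)
    then show ?thesis unfolding rep_def by (rule someI_ex)
  qed
  have "bij_betw (\<lambda>k. {rep k, inv (rep k)}) {1..int m} (lee_partition G - {{\<one>}})"
  proof (rule bij_betw_imageI)
    show "inj_on (\<lambda>k. {rep k, inv (rep k)}) {1..int m}"
    proof (rule inj_onI)
      fix k l
      assume kl: "k \<in> {1..int m}" "l \<in> {1..int m}"
        and "{rep k, inv (rep k)} = {rep l, inv (rep l)}"
      then have "rep k = rep l \<or> rep k = inv (rep l)" by blast
      moreover have r: "rep k \<in> carrier G \<and> w (rep k) = k" "rep l \<in> carrier G \<and> w (rep l) = l"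
        using kl rep[of k] rep[of l] by simp_all
      ultimately have "w (rep k) = w (rep l)"
        using winv by metis
      with r show "k = l" by metis
    qed
    show "(\<lambda>k. {rep k, inv (rep k)}) ` {1..int m} = lee_partition G - {{\<one>}}"
    proof (intro equalityI subsetI)
      fix A assume "A \<in> (\<lambda>k. {rep k, inv (rep k)}) ` {1..int m}"
      then obtain k where k: "k \<in> {1..int m}" "A = {rep k, inv (rep k)}" by blast
      then show "A \<in> lee_partition G - {{\<one>}}"
        using rep[of k] one by (auto simp: lee_partition_def)
    next
      fix A assume A: "A \<in> lee_partition G - {{\<one>}}"
      then obtain a where a: "a \<in> carrier G" "A = {a, inv a}"
        by (auto simp: lee_partition_def)
      with A have "a \<noteq> \<one>" by auto
      then have k: "w a \<in> {1..int m}"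
        using zero[of a] nonneg[of a] a img by force
      then have "rep (w a) = a \<or> rep (w a) \<otimes> a = \<one>"
        using rep[of "w a"] eq[of "rep (w a)" a] a by auto
      then have "rep (w a) = a \<or> rep (w a) = inv a"
        using a k rep[of "w a"] inv_equality[of "rep (w a)" a] by auto
      then have "A = {rep (w a), inv (rep (w a))}" using a by auto
      then show "A \<in> (\<lambda>k. {rep k, inv (rep k)}) ` {1..int m}" using k by blast
    qed
  qed
  then have card: "card (lee_partition G - {{\<one>}}) = m"
    by (simp flip: bij_betw_same_card)
  have "weight G d ` carrier G = real_of_int ` {0..int m}"
    using img wt by (force simp: image_image simp flip: img)
  also have "\<dots> = real ` {0..m}"
    by (simp flip: image_int_atLeastAtMost[of 0 m, simplified] add: image_image)
  finally have "lee_metric G d"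
    using metric part card by (simp add: lee_metric_def interval_metric_def)
  then show ?thesis by blast
qed

section \<open>Evaluation of words and homomorphisms from presented groups\<close>

primrec (in monoid) word_eval :: "('g \<Rightarrow> 'a) \<Rightarrow> 'g word \<Rightarrow> 'a" where
  "word_eval f [] = \<one>"
| "word_eval f (c # u) = (if snd c then f (fst c) else inv (f (fst c))) \<otimes> word_eval f u"

context group
begin

lemma word_eval_closed:
  assumes "range f \<subseteq> carrier G"
  shows "word_eval f u \<in> carrier G"
  using assms by (induction u) auto

lemma word_eval_append:
  assumes "range f \<subseteq> carrier G"
  shows "word_eval f (u @ v) = word_eval f u \<otimes> word_eval f v"
proof (induction u)
  case (Cons c u)
  have "f (fst c) \<in> carrier G" using assms by auto
  with Cons word_eval_closed[OF assms] show ?case by (simp add: m_assoc)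
qed (simp add: word_eval_closed[OF assms])

text \<open>Evaluation is multiplicative, so a rewriting inside a word only has to be checked on the
  piece that is rewritten.\<close>

lemma word_eval_pres_eq:
  assumes "range f \<subseteq> carrier G"
    and "\<And>r s. (r, s) \<in> R \<Longrightarrow> word_eval f r = word_eval f s"
    and "pres_eq R u v"
  shows "word_eval f u = word_eval f v"
  using assms(3)
proof induction
  case (cancel u a b v)
  have "f a \<in> carrier G" using assms(1) by auto
  then have "word_eval f ([(a, b), (a, \<not> b)] @ v) = word_eval f v"
    using word_eval_closed[OF assms(1), of v] by (simp add: inv_solve_left flip: m_assoc)
  then show ?case by (simp only: word_eval_append[OF assms(1)])
qed (simp_all add: word_eval_append[OF assms(1)] assms(2))

end

text \<open>Von Dyck's theorem. The map evaluates a chosen word of each class; by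
  \<open>word_eval_pres_eq\<close> the choice does not matter.\<close>

lemma presented_group_hom:
  assumes "group H" "range f \<subseteq> carrier H"
    and "\<And>r s. (r, s) \<in> R \<Longrightarrow> monoid.word_eval H f r = monoid.word_eval H f s"
  obtains \<phi> where "\<phi> \<in> hom (presented_group R) H"
    "\<And>u. \<phi> (pres_rel R `` {u}) = monoid.word_eval H f u"
proof -
  interpret H: group H by fact
  define \<phi> where "\<phi> A = H.word_eval f (SOME u. u \<in> A)" for A
  have \<phi>: "\<phi> (pres_rel R `` {u}) = H.word_eval f u" for u
  proof -
    have "u \<in> pres_rel R `` {u}" by (simp add: pres_rel_def pres_eq.refl)
    then have "(SOME v. v \<in> pres_rel R `` {u}) \<in> pres_rel R `` {u}" by (rule someI)
    then have "pres_eq R u (SOME v. v \<in> pres_rel R `` {u})"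
      unfolding pres_rel_def by blast
    then show ?thesis
      unfolding \<phi>_def using H.word_eval_pres_eq[OF assms(2,3)] by metis
  qed
  have "\<phi> \<in> hom (presented_group R) H"
  proof (rule homI)
    fix x y
    assume "x \<in> carrier (presented_group R)" "y \<in> carrier (presented_group R)"
    then obtain u v where "x = pres_rel R `` {u}" "y = pres_rel R `` {v}"
      by (auto simp: presented_group_def quotient_def)
    then show "\<phi> x \<in> carrier H" "\<phi> (x \<otimes>\<^bsub>presented_group R\<^esub> y) = \<phi> x \<otimes>\<^bsub>H\<^esub> \<phi> y"
      by (simp_all add: \<phi> presented_group_mult H.word_eval_closed H.word_eval_append assms(2))
  qed
  with \<phi> that show thesis by blast
qed

section \<open>The normal-form model\<close>

text \<open>\<open>(i, b)\<close> stands for \<open>x\<^sup>i y\<^sup>b\<close>; the product is read off from \<open>y x\<^sup>j = x\<^sup>-\<^sup>j y\<close> and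
  \<open>y\<^sup>2 = x\<^sup>n\<close>.\<close>
definition dic_model :: "int \<Rightarrow> (int \<times> bool) monoid" where
  "dic_model n =
     \<lparr> carrier = {0..<2 * n} \<times> UNIV,
       monoid.mult = (\<lambda>(i, b) (j, c).
         ((i + (if b then - j else j) + (if b \<and> c then n else 0)) mod (2 * n), b \<noteq> c)),
       one = (0, False) \<rparr>"

lemma dic_model_simps [simp]:
  "(i, b) \<in> carrier (dic_model n) \<longleftrightarrow> 0 \<le> i \<and> i < 2 * n"
  "(i, b) \<otimes>\<^bsub>dic_model n\<^esub> (j, c) =
     ((i + (if b then - j else j) + (if b \<and> c then n else 0)) mod (2 * n), b \<noteq> c)"
  "\<one>\<^bsub>dic_model n\<^esub> = (0, False)"
  by (auto simp: dic_model_def)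

lemma group_dic_model:
  assumes "n > 0"
  shows "group (dic_model n)"
proof (rule groupI)
  fix x y z :: "int \<times> bool"
  assume x: "x \<in> carrier (dic_model n)"
  obtain i b where xi: "x = (i, b)" by (cases x)
  show "\<one>\<^bsub>dic_model n\<^esub> \<otimes>\<^bsub>dic_model n\<^esub> x = x"
    using x xi by simp
  \<comment> \<open>The inverse of x^i y is x^(i+n) y; the left side is the exponent of their
    product.\<close>
  have "((i + n) mod (2 * n) - i + n) mod (2 * n) = (i + n - i + n) mod (2 * n)"
    by (metis mod_add_left_eq mod_diff_left_eq)
  then show "\<exists>y\<in>carrier (dic_model n). y \<otimes>\<^bsub>dic_model n\<^esub> x = \<one>\<^bsub>dic_model n\<^esub>"
    using assms xi
    by (intro bexI[of _ "(if b then (i + n) mod (2 * n) else (- i) mod (2 * n), b)"])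
      (auto simp: mod_simps)
  obtain j c where yj: "y = (j, c)" by (cases y)
  show "x \<otimes>\<^bsub>dic_model n\<^esub> y \<in> carrier (dic_model n)"
    using assms xi yj by simp
  obtain k e where zk: "z = (k, e)" by (cases z)
  \<comment> \<open>The two bracketings give literally different exponents only when all three
    factors lie in the coset: i - j + k + n against i - j + k - n, which agree modulo 2n.\<close>
  have 2: "(a + 2 * n) mod (2 * n) = a mod (2 * n)" for a by simp
  have m: "(p mod (2 * n) + q + r) mod (2 * n) = (p + q + r) mod (2 * n)"
    "(p mod (2 * n) - q + r) mod (2 * n) = (p - q + r) mod (2 * n)"
    "(p + q mod (2 * n) + r) mod (2 * n) = (p + q + r) mod (2 * n)"
    "(p - q mod (2 * n) + r) mod (2 * n) = (p - q + r) mod (2 * n)" for p q r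
    using mod_add_left_eq[of p "2 * n" "q + r"] mod_add_left_eq[of p "2 * n" "r - q"]
      mod_add_right_eq[of "p + r" q "2 * n"] mod_diff_right_eq[of "p + r" q "2 * n"]
    by (simp_all only: add.assoc add.commute add.left_commute add_diff_eq diff_add_eq)
  show "x \<otimes>\<^bsub>dic_model n\<^esub> y \<otimes>\<^bsub>dic_model n\<^esub> z =
      x \<otimes>\<^bsub>dic_model n\<^esub> (y \<otimes>\<^bsub>dic_model n\<^esub> z)"
    using 2[of "i - j + k - n"]
    by (cases b; cases c; cases e; simp add: xi yj zk mod_simps m; simp add: algebra_simps)
qed (use assms in simp_all)

section \<open>The length function on the model\<close>

lemma mod_eq_shift:
  fixes a m :: int
  assumes "- m \<le> a" "a < 2 * m"
  shows "a mod m = (if a < 0 then a + m else if a < m then a else a - m)"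
  using assms mod_pos_pos_trivial[of "a + m" m] mod_pos_pos_trivial[of "a - m" m] by auto

text \<open>Inversion sends x^i to x^(2n-i) and x^i y to x^(i+n) y, so
  \<open>min i (2 * n - i)\<close> and \<open>i mod n\<close> are constant on inversion classes. On
  the cyclic part this is the weighted word length in which x and x^-1 cost 2 and x^n costs 1. The
  tie 2j = n falls into different branches because it must receive the top value, which is n on the
  cyclic part and n + 1 + (n - 1) on the coset.\<close>

definition dic_length :: "int \<Rightarrow> int \<times> bool \<Rightarrow> int" where
  "dic_length n = (\<lambda>(i, b).
     if b then n + 1 + (let j = i mod n in if 2 * j < n then 2 * j else 2 * (n - j) - 1)
     else (let j = min i (2 * n - i) in if 2 * j \<le> n then 2 * j else 2 * (n - j) + 1))"

lemma dic_length_True: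
  assumes "0 \<le> i" "i < 2 * n"
  shows "dic_length n (i, True) = n + 1 + (if i < n then if 2 * i < n then 2 * i else 2 * (n - i) - 1
     else if 2 * i < 3 * n then 2 * (i - n) else 2 * (2 * n - i) - 1)"
proof -
  have "i mod n = (if i < n then i else i - n)"
    using assms by (simp add: mod_eq_shift)
  then show ?thesis by (simp add: dic_length_def Let_def)
qed

lemma dic_length_False:
  assumes "0 \<le> i" "i < 2 * n"
  shows "dic_length n (i, False) = (if 2 * i \<le> n then 2 * i else if i \<le> n then 2 * (n - i) + 1
     else if 2 * i < 3 * n then 2 * (i - n) + 1 else 2 * (2 * n - i))"
  using assms by (auto simp: dic_length_def Let_def min_def)

lemma dic_length_one: "n > 0 \<Longrightarrow> dic_length n (0, False) = 0"
  by (simp add: dic_length_False)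

text \<open>A weighted word length is subadditive, which settles the cyclic part. On the coset,
  multiplication by x or x^-1 from either side moves one step along the n-cycle and changes the
  length by at most 2, while x^n preserves it; so x^i changes it by at most its own length.\<close>

lemma dic_length_mult:
  assumes "x \<in> carrier (dic_model n)" "y \<in> carrier (dic_model n)"
  shows "dic_length n (x \<otimes>\<^bsub>dic_model n\<^esub> y) \<le> dic_length n x + dic_length n y"
proof -
  obtain i b j c where xy: "x = (i, b)" "y = (j, c)" by (cases x, cases y)
  then have i: "0 \<le> i" "i < 2 * n" and j: "0 \<le> j" "j < 2 * n"
    using assms by auto
  \<comment> \<open>Reducing the exponent takes at most one shift by 2n, so with the piecewise forms
    of the length every case becomes linear arithmetic.\<close>
  have add: "(i + j) mod (2 * n) = (if i + j < 2 * n then i + j else i + j - 2 * n)"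
    using i j by (simp add: mod_eq_shift)
  have diff: "(i - j) mod (2 * n) = (if j \<le> i then i - j else i - j + 2 * n)"
    using i j by (simp add: mod_eq_shift)
  show ?thesis
  proof (cases b; cases c)
    assume b: "b" and c: "c"
    define k where "k = (i - j + n) mod (2 * n)"
    have k: "0 \<le> k" "k < 2 * n" using i by (auto simp: k_def)
    have "dic_length n (k, False) \<le> n" "n < dic_length n (i, True)" "n < dic_length n (j, True)"
      using i j k by (simp_all add: dic_length_False dic_length_True)
    then have "dic_length n (k, False) \<le> dic_length n (i, True) + dic_length n (j, True)"
      using i by simp
    then show ?thesis using b c by (simp add: xy k_def)
  next
    assume b: "b" and c: "\<not> c"
    define k where "k = (i - j) mod (2 * n)"
    have k: "0 \<le> k" "k < 2 * n" using i by (auto simp: k_def)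
    have "dic_length n (k, True) \<le> dic_length n (i, True) + dic_length n (j, False)"
      using i j k diff[folded k_def]
      unfolding dic_length_False[OF j] dic_length_True[OF i] dic_length_True[OF k]
      by (smt (verit))
    then show ?thesis using b c by (simp add: xy k_def)
  next
    assume b: "\<not> b" and c: "c"
    define k where "k = (i + j) mod (2 * n)"
    have k: "0 \<le> k" "k < 2 * n" using i by (auto simp: k_def)
    have "dic_length n (k, True) \<le> dic_length n (i, False) + dic_length n (j, True)"
      using i j k add[folded k_def]
      unfolding dic_length_False[OF i] dic_length_True[OF j] dic_length_True[OF k]
      by (smt (verit))
    then show ?thesis using b c by (simp add: xy k_def)
  next
    assume b: "\<not> b" and c: "\<not> c"
    define k where "k = (i + j) mod (2 * n)"
    have k: "0 \<le> k" "k < 2 * n" using i by (auto simp: k_def)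
    have "dic_length n (k, False) \<le> dic_length n (i, False) + dic_length n (j, False)"
      using i j k add[folded k_def]
      unfolding dic_length_False[OF i] dic_length_False[OF j] dic_length_False[OF k]
      by (smt (verit))
    then show ?thesis using b c by (simp add: xy k_def)
  qed
qed

text \<open>Parity tells whether a value comes from the rising or the falling branch, and each
  branch is injective; so the length determines the distance from i to 0 in the 2n-cycle, or
  \<open>i mod n\<close> on the coset, and hence the element up to inversion. For a mixed pair the
  lengths lie on different sides of n + 1/2, and the product lies in the coset.\<close>

lemma dic_length_eq_iff:
  assumes "x \<in> carrier (dic_model n)" "y \<in> carrier (dic_model n)"
  shows "dic_length n x = dic_length n y \<longleftrightarrow> x = y \<or> x \<otimes>\<^bsub>dic_model n\<^esub> y = \<one>\<^bsub>dic_model n\<^esub>"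
proof -
  obtain i b j c where xy: "x = (i, b)" "y = (j, c)" by (cases x, cases y)
  then have i: "0 \<le> i" "i < 2 * n" and j: "0 \<le> j" "j < 2 * n"
    using assms by auto
  have add: "(i + j) mod (2 * n) = 0 \<longleftrightarrow> i + j = 0 \<or> i + j = 2 * n"
    using i j mod_eq_shift[of "2 * n" "i + j"] by simp
  have diff: "(i - j + n) mod (2 * n) = 0 \<longleftrightarrow> i = j + n \<or> j = i + n"
    using i j mod_eq_shift[of "2 * n" "i - j + n"] by simp linarith
  show ?thesis
  proof (cases b; cases c)
    assume "b" "c"
    then show ?thesis
      using i j by (auto simp: xy diff dic_length_True split: if_splits; presburger)
  next
    assume "b" "\<not> c"
    then show ?thesis
      using i j by (simp add: xy dic_length_True dic_length_False)
  next
    assume "\<not> b" "c"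
    then show ?thesis
      using i j by (simp add: xy dic_length_True dic_length_False)
  next
    assume "\<not> b" "\<not> c"
    then show ?thesis
      using i j by (auto simp: xy add dic_length_False split: if_splits; presburger)
  qed
qed

lemma dic_length_image:
  assumes "n > 0"
  shows "dic_length n ` carrier (dic_model n) = {0..2 * n}"
proof (intro equalityI subsetI)
  fix k assume "k \<in> dic_length n ` carrier (dic_model n)"
  then obtain i b where "0 \<le> i" "i < 2 * n" "k = dic_length n (i, b)" by auto
  then show "k \<in> {0..2 * n}"
    by (cases b) (auto simp: dic_length_True dic_length_False)
next
  fix k assume k: "k \<in> {0..2 * n}"
  \<comment> \<open>Values above n belong to the coset. Even offsets are found on the rising branch,
    odd ones by solving the formula of the falling branch for i.\<close>
  have "\<exists>i. 0 \<le> i \<and> i < 2 * n \<and> dic_length n (i, k > n) = k"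
  proof (cases "k \<le> n")
    case True
    consider q where "k = 2 * q" | q where "k = 2 * q + 1" by (metis evenE oddE)
    then show ?thesis
    proof cases
      case 1
      with True k assms show ?thesis by (intro exI[of _ q]) (simp add: dic_length_False)
    next
      case 2
      with True k assms show ?thesis by (intro exI[of _ "n - q"]) (simp add: dic_length_False)
    qed
  next
    case False
    consider q where "k - n - 1 = 2 * q" | q where "k - n - 1 = 2 * q + 1" by (metis evenE oddE)
    then show ?thesis
    proof cases
      case 1
      with False k assms show ?thesis by (intro exI[of _ q]) (simp add: dic_length_True)
    next
      case 2
      with False k assms show ?thesis by (intro exI[of _ "n - q - 1"]) (simp add: dic_length_True)
    qed
  qed
  then show "k \<in> dic_length n ` carrier (dic_model n)"
    by (metis image_eqI dic_model_simps(1))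
qed

section \<open>The isomorphism between the presented group and the model\<close>

lemma (in group) word_eval_replicate:
  assumes "range f \<subseteq> carrier G"
  shows "word_eval f (replicate k (a, True)) = f a [^] k"
proof (induction k)
  case (Suc k)
  have "f a \<in> carrier G" using assms by auto
  with Suc show ?case using nat_pow_Suc2[of "f a" k] by simp
qed simp

lemma (in group_hom) hom_word_eval:
  assumes "range f \<subseteq> carrier G"
  shows "h (G.word_eval f u) = H.word_eval (h \<circ> f) u"
proof (induction u)
  case (Cons c u)
  have "f (fst c) \<in> carrier G" using assms by auto
  with Cons G.word_eval_closed[OF assms] show ?case by simp
qed simp

text \<open>The class of a formal inverse letter is the group inverse, so concatenation rebuilds the
  class of a word from the classes of its letters. It reduces identities of homomorphisms to the
  generators.\<close>

lemma presented_group_word_eval: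
  "monoid.word_eval (presented_group R) (\<lambda>a. pres_rel R `` {[(a, True)]}) u = pres_rel R `` {u}"
proof -
  interpret group "presented_group R" by (rule group_presented_group)
  have carr: "pres_rel R `` {v} \<in> carrier (presented_group R)" for v
    by (auto simp: presented_group_def quotient_def)
  have one: "\<one>\<^bsub>presented_group R\<^esub> = pres_rel R `` {[]}"
    by (simp add: presented_group_def)
  have inverse: "inv\<^bsub>presented_group R\<^esub> (pres_rel R `` {[(a, True)]}) = pres_rel R `` {[(a, False)]}" for a
  proof (rule inv_equality)
    have "([(a, False), (a, True)], []) \<in> pres_rel R"
      using pres_eq.cancel[of R "[]" a False "[]"] by (simp add: pres_rel_def)
    then show "pres_rel R `` {[(a, False)]} \<otimes>\<^bsub>presented_group R\<^esub> pres_rel R `` {[(a, True)]}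
        = \<one>\<^bsub>presented_group R\<^esub>"
      unfolding one presented_group_mult by (simp add: equiv_class_eq[OF equiv_pres_rel])
  qed (rule carr)+
  show ?thesis
  proof (induction u)
    case (Cons c u)
    then show ?case
      by (cases c) (auto simp: inverse presented_group_mult)
  qed (simp add: one)
qed

lemma presented_group_relation:
  assumes "(r, s) \<in> R"
  shows "pres_rel R `` {r} = pres_rel R `` {s}"
  using pres_eq.rel[OF assms, of "[]" "[]"]
  by (intro equiv_class_eq[OF equiv_pres_rel]) (simp add: pres_rel_def)

lemma (in group) int_pow_skew_commute:
  assumes "x \<in> carrier G" "y \<in> carrier G" "y \<otimes> x = inv x \<otimes> y"
  shows "y \<otimes> x [^] (k::int) = x [^] (- k) \<otimes> y"
proof -
  \<comment> \<open>Stated for every a that y inverts, so that it serves x for nonnegative exponents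
    and x^-1 for negative ones.\<close>
  have nat: "y \<otimes> a [^] m = inv a [^] m \<otimes> y"
    if "a \<in> carrier G" "y \<otimes> a = inv a \<otimes> y" for a and m :: nat
  proof (induction m)
    case (Suc m)
    have "y \<otimes> a [^] Suc m = (y \<otimes> a [^] m) \<otimes> a"
      using that assms by (simp add: m_assoc)
    also have "\<dots> = inv a [^] m \<otimes> (y \<otimes> a)"
      using Suc that assms by (simp add: m_assoc)
    also have "\<dots> = inv a [^] Suc m \<otimes> y"
      using that assms by (simp add: m_assoc)
    finally show ?case .
  qed (use assms in simp)
  have "x \<otimes> (y \<otimes> x) = y"
    using assms by (simp flip: m_assoc)
  then have inv: "y \<otimes> inv x = x \<otimes> y"
    using assms by (metis inv_solve_right' m_assoc m_closed)
  show ?thesis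
  proof (cases k rule: int_cases2)
    case (nonneg m)
    then show ?thesis
      using nat[of x m] assms by (simp add: int_pow_int int_pow_neg_int nat_pow_inv)
  next
    case (nonpos m)
    then show ?thesis
      using nat[of "inv x" m] assms inv by (simp add: int_pow_int int_pow_neg_int nat_pow_inv)
  qed
qed

text \<open>Each relation supplies one ingredient of the product rule of the model: exponents count
  modulo 2n, y^2 equals x^n, and y moves past x^j by inverting it.\<close>

lemma (in group) dic_model_hom:
  assumes x: "x \<in> carrier G" and y: "y \<in> carrier G"
    and "x [^] (2 * n) = \<one>" "y \<otimes> y = x [^] n" "inv y \<otimes> x \<otimes> y = inv x"
  shows "(\<lambda>(i, b). x [^] i \<otimes> (if b then y else \<one>)) \<in> hom (dic_model (int n)) G"
proof -
  have mod: "x [^] (i mod (2 * int n)) = x [^] i" for i :: int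
  proof -
    have "x [^] (2 * int n) = \<one>"
      using assms(3) int_pow_int[of G x "2 * n"] by simp
    then have "x [^] (2 * int n * (i div (2 * int n))) = \<one>"
      using x by (simp flip: int_pow_pow)
    then have "x [^] (2 * int n * (i div (2 * int n)) + i mod (2 * int n)) = x [^] (i mod (2 * int n))"
      using x int_pow_mult[of x "2 * int n * (i div (2 * int n))" "i mod (2 * int n)"]
      by (simp del: mult_div_mod_eq)
    then show ?thesis by simp
  qed
  have "x \<otimes> y = y \<otimes> inv x"
    using assms by (metis inv_closed inv_solve_left m_assoc m_closed)
  then have "y \<otimes> x = inv x \<otimes> y"
    using x y by (metis inv_closed inv_solve_left inv_solve_right m_assoc m_closed)
  then have comm: "y \<otimes> x [^] j = x [^] (- j) \<otimes> y" for j :: int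
    by (rule int_pow_skew_commute[OF x y])
  \<comment> \<open>The same commutation inside a product bracketed to the right.\<close>
  have comm': "y \<otimes> (x [^] j \<otimes> z) = x [^] (- j) \<otimes> (y \<otimes> z)" if "z \<in> carrier G" for j :: int and z
    using comm[of j] x y that by (metis int_pow_closed m_assoc)
  have yy: "y \<otimes> y = x [^] int n"
    using assms by (simp add: int_pow_int)
  show ?thesis
  proof (rule homI)
    fix p q :: "int \<times> bool"
    obtain i b j c where pq: "p = (i, b)" "q = (j, c)" by (cases p, cases q)
    show "(case p of (i, b) \<Rightarrow> x [^] i \<otimes> (if b then y else \<one>)) \<in> carrier G"
      using x y by (simp add: pq)
    show "(case p \<otimes>\<^bsub>dic_model (int n)\<^esub> q of (i, b) \<Rightarrow> x [^] i \<otimes> (if b then y else \<one>)) =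
        (case p of (i, b) \<Rightarrow> x [^] i \<otimes> (if b then y else \<one>)) \<otimes>
        (case q of (i, b) \<Rightarrow> x [^] i \<otimes> (if b then y else \<one>))"
      using x y
      by (cases b; cases c) (simp_all add: pq mod comm comm' yy int_pow_mult int_pow_diff
        int_pow_neg m_assoc)
  qed
qed

text \<open>The relations allow every element to be written in normal form, and the model shows that
  distinct normal forms stay distinct. \<open>\<phi>\<close> evaluates words in the model,
  \<open>\<psi>\<close> reads a normal form in the presented group, and they are mutually
  inverse.\<close>

lemma dicyclic_iso_dic_model:
  assumes "n > 0"
  obtains \<phi> where "\<phi> \<in> hom (dicyclic n) (dic_model (int n))"
    "inj_on \<phi> (carrier (dicyclic n))" "\<phi> ` carrier (dicyclic n) = carrier (dic_model (int n))"
proof -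
  define R where "R = {(replicate (2 * n) (GenX, True), []),
      ([(GenY, True), (GenY, True)], replicate n (GenX, True)),
      ([(GenY, False), (GenX, True), (GenY, True)], [(GenX, False)])}"
  have G: "dicyclic n = presented_group R"
    by (simp add: dicyclic_def R_def)
  define f where "f = (\<lambda>a. case a of GenX \<Rightarrow> (1::int, False) | GenY \<Rightarrow> (0, True))"
  define g where "g a = pres_rel R `` {[(a, True)]}" for a
  interpret G: group "presented_group R" by (rule group_presented_group)
  interpret H: group "dic_model (int n)" using assms by (intro group_dic_model) simp
  have f: "range f \<subseteq> carrier (dic_model (int n))"
    using assms by (auto simp: f_def split: dicyclic_gen.split)
  have g: "range g \<subseteq> carrier (presented_group R)"
    by (auto simp: g_def presented_group_def quotient_def)
  have pow: "(1, False) [^]\<^bsub>dic_model (int n)\<^esub> k = (int k mod (2 * int n), False)" for k :: nat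
    by (induction k) (simp_all add: mod_simps add.commute)
  have invX: "inv\<^bsub>dic_model (int n)\<^esub> (1, False) = (2 * int n - 1, False)"
    using assms by (intro H.inv_equality) auto
  have invY: "inv\<^bsub>dic_model (int n)\<^esub> (0, True) = (int n, True)"
    using assms by (intro H.inv_equality) auto
  have eval: "H.word_eval f r = H.word_eval f s" if "(r, s) \<in> R" for r s
    using that assms unfolding R_def
    by (auto simp: H.word_eval_replicate[OF f]) (auto simp: f_def pow invX invY mod_pos_pos_trivial)
  obtain \<phi> where \<phi>: "\<phi> \<in> hom (presented_group R) (dic_model (int n))"
    "\<And>u. \<phi> (pres_rel R `` {u}) = H.word_eval f u"
    using presented_group_hom[OF H.is_group f eval] by blast
  interpret \<phi>: group_hom "presented_group R" "dic_model (int n)" \<phi>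
    using \<phi>(1) by unfold_locales
  define \<psi> where "\<psi> = (\<lambda>(i::int, b). g GenX [^]\<^bsub>presented_group R\<^esub> i \<otimes>\<^bsub>presented_group R\<^esub>
      (if b then g GenY else \<one>\<^bsub>presented_group R\<^esub>))"
  have rel: "G.word_eval g r = G.word_eval g s" if "(r, s) \<in> R" for r s
    using presented_group_relation[OF that] presented_group_word_eval[of R]
    by (simp add: g_def[abs_def])
  have R: "(replicate (2 * n) (GenX, True), []) \<in> R"
    "([(GenY, True), (GenY, True)], replicate n (GenX, True)) \<in> R"
    "([(GenY, False), (GenX, True), (GenY, True)], [(GenX, False)]) \<in> R"
    by (auto simp: R_def)
  have gc: "g a \<in> carrier (presented_group R)" for a using g by auto
  have "\<psi> \<in> hom (dic_model (int n)) (presented_group R)"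
    unfolding \<psi>_def
  proof (rule G.dic_model_hom[OF gc gc])
    show "g GenX [^]\<^bsub>presented_group R\<^esub> (2 * n) = \<one>\<^bsub>presented_group R\<^esub>"
      using rel[OF R(1)]
      by (simp add: G.word_eval_replicate[OF g])
    show "g GenY \<otimes>\<^bsub>presented_group R\<^esub> g GenY = g GenX [^]\<^bsub>presented_group R\<^esub> n"
      using rel[OF R(2)] gc
      by (simp add: G.word_eval_replicate[OF g])
    show "inv\<^bsub>presented_group R\<^esub> g GenY \<otimes>\<^bsub>presented_group R\<^esub> g GenX \<otimes>\<^bsub>presented_group R\<^esub> g GenY
        = inv\<^bsub>presented_group R\<^esub> g GenX"
      using rel[OF R(3)] gc
      by (simp add: G.m_assoc)
  qed
  then interpret \<psi>: group_hom "dic_model (int n)" "presented_group R" \<psi>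
    by unfold_locales
  have \<psi>f: "\<psi> \<circ> f = g"
    using gc by (auto simp: \<psi>_def f_def fun_eq_iff split: dicyclic_gen.split)
  \<comment> \<open>Applying \<open>\<psi>\<close> after evaluation at \<open>f\<close> is
    evaluation at \<open>g\<close>, the generator classes, which returns the class of the
    word.\<close>
  have \<psi>\<phi>: "\<psi> (\<phi> A) = A" if A: "A \<in> carrier (presented_group R)" for A
  proof -
    obtain u where "A = pres_rel R `` {u}"
      using A by (auto simp: presented_group_def quotient_def)
    then show ?thesis
      using presented_group_word_eval[of R u]
      by (simp add: \<phi>(2) \<psi>.hom_word_eval[OF f] \<psi>f g_def[abs_def])
  qed
  have \<phi>g: "\<phi> (g a) = f a" for a
  proof -
    have "f a \<in> carrier (dic_model (int n))" using f by auto
    then show ?thesis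
      using H.r_one by (simp add: g_def \<phi>(2) del: dic_model_simps)
  qed
  \<comment> \<open>\<open>\<phi>\<close> turns the normal form into a power of (1, False), times
    (0, True) when b holds; as 0 \<le> i < 2n, reduction leaves the exponent i unchanged.\<close>
  have \<phi>\<psi>: "\<phi> (\<psi> p) = p" if p: "p \<in> carrier (dic_model (int n))" for p
  proof -
    obtain i b where ib: "p = (i, b)" by (cases p)
    with p have "0 \<le> i" "i < 2 * int n" by auto
    then show ?thesis
      using gc assms pow[of "nat i"] int_pow_int[of "dic_model (int n)" "(1, False)" "nat i"]
      by (auto simp: ib \<psi>_def \<phi>g f_def \<phi>.hom_int_pow)
  qed
  show thesis
  proof (rule that)
    show "\<phi> \<in> hom (dicyclic n) (dic_model (int n))" using \<phi>(1) by (simp add: G)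
    show "inj_on \<phi> (carrier (dicyclic n))" using \<psi>\<phi> unfolding G by (rule inj_on_inverseI)
    have "p \<in> \<phi> ` carrier (presented_group R)" if "p \<in> carrier (dic_model (int n))" for p
      using \<phi>\<psi>[OF that] \<psi>.hom_closed[OF that] by force
    then show "\<phi> ` carrier (dicyclic n) = carrier (dic_model (int n))"
      unfolding G using \<phi>.hom_closed by blast
  qed
qed

section \<open>Transport of the length to the dicyclic group\<close>

theorem theorem3p9:
  fixes n :: nat
  assumes "n \<ge> 2"
  shows "\<exists>d. lee_metric (dicyclic n) d"
proof -
  obtain \<phi> where \<phi>: "\<phi> \<in> hom (dicyclic n) (dic_model (int n))"
    "inj_on \<phi> (carrier (dicyclic n))" "\<phi> ` carrier (dicyclic n) = carrier (dic_model (int n))"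
    using dicyclic_iso_dic_model[of n] assms by auto
  have G: "group (dicyclic n)"
    by (simp add: dicyclic_def group_presented_group)
  have H: "group (dic_model (int n))"
    using assms by (intro group_dic_model) simp
  interpret \<phi>: group_hom "dicyclic n" "dic_model (int n)" \<phi>
    using G H \<phi>(1) by (simp add: group_hom_def group_hom_axioms_def)
  show ?thesis
  \<comment> \<open>The value m = 2n counts the nontrivial inversion classes: n among the powers of
    x and n in the coset.\<close>
  proof (rule lee_metric_of_length[OF G, where w = "dic_length (int n) \<circ> \<phi>" and m = "2 * n"])
    show "(dic_length (int n) \<circ> \<phi>) \<one>\<^bsub>dicyclic n\<^esub> = 0"
      using assms by (simp add: dic_length_one)
    show "(dic_length (int n) \<circ> \<phi>) ` carrier (dicyclic n) = {0..int (2 * n)}"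
      using assms dic_length_image[of "int n"] by (simp only: image_comp[symmetric] \<phi>(3)) simp
    fix x y
    assume x: "x \<in> carrier (dicyclic n)" and y: "y \<in> carrier (dicyclic n)"
    show "(dic_length (int n) \<circ> \<phi>) (x \<otimes>\<^bsub>dicyclic n\<^esub> y)
        \<le> (dic_length (int n) \<circ> \<phi>) x + (dic_length (int n) \<circ> \<phi>) y"
      using x y dic_length_mult[of "\<phi> x" "int n" "\<phi> y"] by simp
    have "\<phi> x \<otimes>\<^bsub>dic_model (int n)\<^esub> \<phi> y = \<one>\<^bsub>dic_model (int n)\<^esub> \<longleftrightarrow> x \<otimes>\<^bsub>dicyclic n\<^esub> y = \<one>\<^bsub>dicyclic n\<^esub>"
      using inj_on_eq_iff[OF \<phi>(2), of "x \<otimes>\<^bsub>dicyclic n\<^esub> y" "\<one>\<^bsub>dicyclic n\<^esub>"] x y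
      by (simp del: dic_model_simps)
    then show "(dic_length (int n) \<circ> \<phi>) x = (dic_length (int n) \<circ> \<phi>) y
        \<longleftrightarrow> x = y \<or> x \<otimes>\<^bsub>dicyclic n\<^esub> y = \<one>\<^bsub>dicyclic n\<^esub>"
      using dic_length_eq_iff[of "\<phi> x" "int n" "\<phi> y"] inj_on_eq_iff[OF \<phi>(2) x y] x y
      by (simp del: dic_model_simps)
  qed
qed

end
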